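(* The map $$P:\mu^{-1}(0)^{rss}\to\mathbb{C}^{2n}\setminus\Delta_n,\qquad (r,s,i,j)\mapsto(r_{11},\ldots,r_{nn},s'_{11},\ldots,s'_{nn}),$$ where $$s'_{\iota\iota}=\left[\mathrm{tr}\Big(\prod_{1\le k\le n,\,k\ne\iota} l_k(r)\Big)\right]^{-1}\mathrm{tr}\Big(\prod_{1\le k\le n,\,k\ne\iota} l_k(r)\; s\Big),$$ is a regular, well-defined, $B$-invariant and surjective map which separates orbit closures (i.e. if the closures $\overline{B.p_1}$ and $\overline{B.p_2}$ in $\mu^{-1}(0)^{rss}$ of the $B$-orbits of two points $p_1,p_2$ are disjoint, then $P(p_1)\ne P(p_2)$).
   Context: Let $n\ge 1$, $\mathfrak{g}=\mathfrak{gl}_n(\mathbb{C})$, $B\subset GL_n(\mathbb{C})$ the group of invertible upper triangular matrices, $\mathfrak{b}$ its Lie algebra (upper triangular matrices), $\mathfrak{u}\subset\mathfrak{g}$ the strictly upper triangular matrices. Identify $\mathfrak{b}^*\cong\mathfrak{g}/\mathfrak{u}$ via the trace pairing $(r,s)\mapsto\mathrm{tr}(rs)$; $\overline{v}$ is the class of $v\in\mathfrak{g}$ in $\mathfrak{g}/\mathfrak{u}$; an element of $\mathfrak{b}^*$ has a unique lower triangular representative $s=(s_{\iota\gamma})$. Identify $T^*(\mathfrak{b}\times\mathbb{C}^n)=\mathfrak{b}\times\mathfrak{b}^*\times\mathbb{C}^n\times(\mathbb{C}^n)^*$, with points $(r,s,i,j)$, $i$ a column vector and $j$ a row vector. $B$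 acts by $b.(r,s,i,j)=(brb^{-1},\overline{bsb^{-1}},bi,jb^{-1})$. The moment map is $\mu(r,s,i,j)=\overline{[r,s]+ij}\in\mathfrak{b}^*$, and $\mu^{-1}(0)^{rss}=\{(r,s,i,j)\in\mu^{-1}(0): r\text{ has pairwise distinct eigenvalues}\}$. For $r=(r_{\iota\gamma})\in\mathfrak{b}$, $l_k(r)=r-r_{kk}I_n$ (empty product is $I_n$). The trace of an upper triangular matrix times $s\in\mathfrak{g}/\mathfrak{u}$ is well defined. $\Delta_n\subset\mathbb{C}^{2n}$ is such that $$\mathbb{C}^{2n}\setminus\Delta_n=\{(x_{11},\ldots,x_{nn},y_{11},\ldots,y_{nn}): x_{\iota\iota}\ne x_{\gamma\gamma}\text{ whenever }\iota\ne\gamma\}.$$ *)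

theory Defs
  imports "HOL-Analysis.Analysis"
begin

section \<open>Affine varieties in coordinates\<close>

text \<open>An affine space is given by a set \<open>C\<close> of coordinate functions on a type of points.
  \<open>poly_funs C\<close> is the algebra of polynomial functions in these coordinates.\<close>

inductive_set poly_funs :: "('p \<Rightarrow> complex) set \<Rightarrow> ('p \<Rightarrow> complex) set"
  for C :: "('p \<Rightarrow> complex) set" where
  const: "(\<lambda>_. c) \<in> poly_funs C"
| coord: "f \<in> C \<Longrightarrow> f \<in> poly_funs C"
| add: "f \<in> poly_funs C \<Longrightarrow> g \<in> poly_funs C \<Longrightarrow> (\<lambda>p. f p + g p) \<in> poly_funs C"
| mult: "f \<in> poly_funs C \<Longrightarrow> g \<in> poly_funs C \<Longrightarrow> (\<lambda>p. f p * g p) \<in> poly_funs C"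

text \<open>The subspace topology that \<open>X\<close> inherits from the Zariski topology: the closed sets are the
  zero loci in \<open>X\<close> of sets \<open>F\<close> of polynomial functions.\<close>

definition zariski :: "('p \<Rightarrow> complex) set \<Rightarrow> 'p set \<Rightarrow> 'p topology" where
  "zariski C X = topology (\<lambda>U. \<exists>F \<subseteq> poly_funs C. U = X - {p \<in> X. \<forall>f\<in>F. f p = 0})"

lemma istopology_zariski:
  "istopology (\<lambda>U. \<exists>F \<subseteq> poly_funs C. U = X - {p \<in> X. \<forall>f\<in>F. f p = 0})"
  (is "istopology ?open")
  unfolding istopology_def
proof (intro conjI allI impI)
  fix S T assume "?open S" "?open T"
  then obtain F G where F: "F \<subseteq> poly_funs C" "S = X - {p \<in> X. \<forall>f\<in>F. f p = 0}"
    and G: "G \<subseteq> poly_funs C" "T = X - {p \<in> X. \<forall>f\<in>G. f p = 0}" by blast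
  define H where "H = {h. \<exists>f\<in>F. \<exists>g\<in>G. h = (\<lambda>p. f p * g p)}"
  have "H \<subseteq> poly_funs C" using F(1) G(1) by (auto simp: H_def intro!: poly_funs.mult)
  moreover have "S \<inter> T = X - {p \<in> X. \<forall>f\<in>H. f p = 0}"
    unfolding F(2) G(2) H_def by fastforce
  ultimately show "?open (S \<inter> T)" by blast
next
  fix K assume K: "\<forall>S\<in>K. ?open S"
  define H where "H = \<Union>{F. F \<subseteq> poly_funs C \<and> X - {p \<in> X. \<forall>f\<in>F. f p = 0} \<in> K}"
  have "H \<subseteq> poly_funs C" by (auto simp: H_def)
  moreover have "\<Union>K = X - {p \<in> X. \<forall>f\<in>H. f p = 0}"
  proof
    show "\<Union>K \<subseteq> X - {p \<in> X. \<forall>f\<in>H. f p = 0}"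
    proof
      fix p assume "p \<in> \<Union>K"
      then obtain S where S: "S \<in> K" "p \<in> S" by blast
      then obtain F where "F \<subseteq> poly_funs C" "S = X - {p \<in> X. \<forall>f\<in>F. f p = 0}" using K by blast
      then show "p \<in> X - {p \<in> X. \<forall>f\<in>H. f p = 0}" using S by (auto simp: H_def)
    qed
    show "X - {p \<in> X. \<forall>f\<in>H. f p = 0} \<subseteq> \<Union>K" by (auto simp: H_def)
  qed
  ultimately show "?open (\<Union>K)" by blast
qed

lemma openin_zariski:
  "openin (zariski C X) U \<longleftrightarrow> (\<exists>F \<subseteq> poly_funs C. U = X - {p \<in> X. \<forall>f\<in>F. f p = 0})"
  unfolding zariski_def by (subst topology_inverse'[OF istopology_zariski]) (rule refl)

lemma topspace_zariski: "topspace (zariski C X) = X"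
proof
  show "topspace (zariski C X) \<subseteq> X"
    unfolding topspace_def by (auto simp: openin_zariski)
  have "openin (zariski C X) X"
    unfolding openin_zariski
    by (rule exI[of _ "{\<lambda>_. 1}"]) (auto intro: poly_funs.const)
  then show "X \<subseteq> topspace (zariski C X)" by (rule openin_subset)
qed

text \<open>For locally closed \<open>X\<close> these are the regular functions of the quasi-affine variety \<open>X\<close>.\<close>

definition regular_fun :: "('p \<Rightarrow> complex) set \<Rightarrow> 'p set \<Rightarrow> ('p \<Rightarrow> complex) \<Rightarrow> bool" where
  "regular_fun C X f \<longleftrightarrow> (\<forall>p\<in>X. \<exists>U g h. openin (zariski C X) U \<and> p \<in> U \<and>
     g \<in> poly_funs C \<and> h \<in> poly_funs C \<and> (\<forall>q\<in>U. h q \<noteq> 0 \<and> f q = g q / h q))"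

definition regular_map ::
  "('p \<Rightarrow> complex) set \<Rightarrow> 'p set \<Rightarrow> ('q \<Rightarrow> complex) set \<Rightarrow> 'q set \<Rightarrow> ('p \<Rightarrow> 'q) \<Rightarrow> bool" where
  "regular_map C X D Y f \<longleftrightarrow> f ` X \<subseteq> Y \<and> (\<forall>d\<in>D. regular_fun C X (\<lambda>p. d (f p)))"


section \<open>Triangular matrices\<close>

text \<open>The index type \<open>'n\<close> of class \<open>{finite, wellorder}\<close> plays the role of \<open>1 < \<dots> < n\<close>. Note that
  on \<open>complex^'n^'n\<close> the matrix product is \<open>**\<close>, while \<open>*\<close> is entrywise.\<close>

type_synonym 'n cvec = "complex^'n"
type_synonym 'n cmat = "complex^'n^'n"

definition borel_alg :: "('n::{finite,wellorder}) cmat set" where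
  "borel_alg = {A. \<forall>a b. b < a \<longrightarrow> A $ a $ b = 0}"

definition borel_grp :: "('n::{finite,wellorder}) cmat set" where
  "borel_grp = {A \<in> borel_alg. invertible A}"

definition strict_upper :: "('n::{finite,wellorder}) cmat set" where
  "strict_upper = {A. \<forall>a b. b \<le> a \<longrightarrow> A $ a $ b = 0}"

definition lower_triangular :: "('n::{finite,wellorder}) cmat \<Rightarrow> bool" where
  "lower_triangular A \<longleftrightarrow> (\<forall>a b. a < b \<longrightarrow> A $ a $ b = 0)"


section \<open>The dual of the Borel subalgebra as a quotient of matrices\<close>

definition cong_u :: "(('n::{finite,wellorder}) cmat \<times> 'n cmat) set" where
  "cong_u = {(v, w). v - w \<in> strict_upper}"

definition cls :: "('n::{finite,wellorder}) cmat \<Rightarrow> 'n cmat set" where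
  "cls v = cong_u `` {v}"

definition borel_dual :: "('n::{finite,wellorder}) cmat set set" where
  "borel_dual = UNIV // cong_u"

definition lower_rep :: "('n::{finite,wellorder}) cmat set \<Rightarrow> 'n cmat" where
  "lower_rep S = (THE v. v \<in> S \<and> lower_triangular v)"

text \<open>The trace of \<open>A ** s\<close> for upper triangular \<open>A\<close> and a class \<open>s\<close>.\<close>

definition trace_dual :: "('n::{finite,wellorder}) cmat \<Rightarrow> 'n cmat set \<Rightarrow> complex" where
  "trace_dual A S = the_elem ((\<lambda>v. trace (A ** v)) ` S)"


section \<open>The moment map\<close>

type_synonym 'n point = "'n cmat \<times> 'n cmat set \<times> 'n cvec \<times> 'n cvec"

definition cotangent :: "('n::{finite,wellorder}) point set" where
  "cotangent = {(r, S, i, j). r \<in> borel_alg \<and> S \<in> borel_dual}"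

definition cotangent_coords :: "(('n::{finite,wellorder}) point \<Rightarrow> complex) set" where
  "cotangent_coords =
     {\<lambda>(r, S, i, j). r $ a $ b | a b. a \<le> b} \<union>
     {\<lambda>(r, S, i, j). lower_rep S $ a $ b | a b. b \<le> a} \<union>
     {\<lambda>(r, S, i, j). i $ a | a. True} \<union>
     {\<lambda>(r, S, i, j). j $ a | a. True}"

text \<open>In \<open>act\<close> and \<open>moment\<close> the union over the representatives \<open>v\<close> of \<open>S\<close> is a union of equal
  classes, see \<open>act_cls\<close> and \<open>moment_cls\<close> below.\<close>

definition act :: "('n::{finite,wellorder}) cmat \<Rightarrow> 'n point \<Rightarrow> 'n point" where
  "act b = (\<lambda>(r, S, i, j).
     (b ** r ** matrix_inv b, \<Union>v\<in>S. cls (b ** v ** matrix_inv b), b *v i, j v* matrix_inv b))"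

definition orbit :: "('n::{finite,wellorder}) point \<Rightarrow> 'n point set" where
  "orbit p = {act b p | b. b \<in> borel_grp}"

definition outer_prod :: "('n::{finite,wellorder}) cvec \<Rightarrow> 'n cvec \<Rightarrow> 'n cmat" where
  "outer_prod i j = (\<chi> a b. i $ a * j $ b)"

definition moment :: "('n::{finite,wellorder}) point \<Rightarrow> 'n cmat set" where
  "moment = (\<lambda>(r, S, i, j). \<Union>v\<in>S. cls (r ** v - v ** r + outer_prod i j))"

definition eigenvalues :: "('n::{finite,wellorder}) cmat \<Rightarrow> complex set" where
  "eigenvalues r = {c. \<exists>v. v \<noteq> 0 \<and> r *v v = c *s v}"

text \<open>The eigenvalues of \<open>r\<close>, counted with multiplicity, are pairwise distinct iff \<open>r\<close> has
  \<open>n\<close> different eigenvalues.\<close>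

definition zero_fibre_rss :: "('n::{finite,wellorder}) point set" where
  "zero_fibre_rss = {(r, S, i, j) \<in> cotangent.
     moment (r, S, i, j) = cls 0 \<and> card (eigenvalues r) = CARD('n)}"


section \<open>The map to the configuration space\<close>

definition lmat :: "('n::{finite,wellorder}) cmat \<Rightarrow> 'n \<Rightarrow> 'n cmat" where
  "lmat r k = r - mat (r $ k $ k)"

definition lprod :: "('n::{finite,wellorder}) cmat \<Rightarrow> 'n \<Rightarrow> 'n cmat" where
  "lprod r c = foldr (\<lambda>k M. lmat r k ** M) (sorted_list_of_set (UNIV - {c})) (mat 1)"

definition sdiag :: "('n::{finite,wellorder}) cmat \<Rightarrow> 'n cmat set \<Rightarrow> 'n \<Rightarrow> complex" where
  "sdiag r S c = inverse (trace (lprod r c)) * trace_dual (lprod r c) S"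

definition Pmap :: "('n::{finite,wellorder}) point \<Rightarrow> 'n cvec \<times> 'n cvec" where
  "Pmap = (\<lambda>(r, S, i, j). (\<chi> c. r $ c $ c, \<chi> c. sdiag r S c))"

text \<open>The complement of \<open>\<Delta>\<^sub>n\<close> in \<open>\<complex>\<^sup>2\<^sup>n = \<complex>\<^sup>n \<times> \<complex>\<^sup>n\<close>.\<close>

definition config :: "(('n::{finite,wellorder}) cvec \<times> 'n cvec) set" where
  "config = {(x, y). \<forall>a b. a \<noteq> b \<longrightarrow> x $ a \<noteq> x $ b}"

definition config_coords ::
  "(('n::{finite,wellorder}) cvec \<times> 'n cvec \<Rightarrow> complex) set" where
  "config_coords = {\<lambda>(x, y). x $ a | a. True} \<union> {\<lambda>(x, y). y $ a | a. True}"


section \<open>Independence of the choices made above\<close>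

lemma mem_cls: "w \<in> cls v \<longleftrightarrow> v - w \<in> strict_upper"
  by (simp add: cls_def cong_u_def)

lemma cls_eq_iff: "cls v = cls w \<longleftrightarrow> v - w \<in> strict_upper"
proof
  assume "cls v = cls w"
  moreover have "w \<in> cls w" by (simp add: mem_cls strict_upper_def)
  ultimately show "v - w \<in> strict_upper" by (simp add: mem_cls[symmetric])
next
  assume "v - w \<in> strict_upper"
  then show "cls v = cls w" by (auto simp: mem_cls strict_upper_def)
qed

lemma borel_dual_eq: "borel_dual = range cls"
  by (auto simp: borel_dual_def cls_def quotient_def)

lemma lower_rep_cls: "lower_rep (cls v) = (\<chi> a b. if b \<le> a then v $ a $ b else 0)"
  unfolding lower_rep_def
proof (rule the_equality)
  fix w assume w: "w \<in> cls v \<and> lower_triangular w"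
  have "w $ a $ b = (if b \<le> a then v $ a $ b else 0)" for a b
    using w by (auto simp: mem_cls strict_upper_def lower_triangular_def not_le)
  then show "w = (\<chi> a b. if b \<le> a then v $ a $ b else 0)" by (simp add: vec_eq_iff)
qed (auto simp: mem_cls strict_upper_def lower_triangular_def)

lemma matrix_diff_ldistrib: "A ** (B - C) = A ** B - A ** (C :: ('n::{finite,wellorder}) cmat)"
  by (vector matrix_matrix_mult_def sum_subtractf[symmetric] right_diff_distrib)

lemma matrix_diff_rdistrib: "(B - C) ** A = B ** A - C ** (A :: ('n::{finite,wellorder}) cmat)"
  by (vector matrix_matrix_mult_def sum_subtractf[symmetric] left_diff_distrib)

lemma borel_mult_strict_upper:
  assumes "A \<in> borel_alg" "U \<in> strict_upper" shows "A ** U \<in> strict_upper"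
  unfolding strict_upper_def matrix_matrix_mult_def
proof (clarsimp, intro sum.neutral ballI)
  fix a b k :: 'a assume "b \<le> a"
  show "A $ a $ k * U $ k $ b = 0"
    using assms \<open>b \<le> a\<close> by (cases "k < a") (auto simp: borel_alg_def strict_upper_def)
qed

lemma strict_upper_mult_borel:
  assumes "A \<in> borel_alg" "U \<in> strict_upper" shows "U ** A \<in> strict_upper"
  unfolding strict_upper_def matrix_matrix_mult_def
proof (clarsimp, intro sum.neutral ballI)
  fix a b k :: 'a assume "b \<le> a"
  show "U $ a $ k * A $ k $ b = 0"
    using assms \<open>b \<le> a\<close> by (cases "k \<le> a") (auto simp: borel_alg_def strict_upper_def)
qed

lemma trace_dual_cls:
  assumes "A \<in> borel_alg" shows "trace_dual A (cls v) = trace (A ** v)"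
proof -
  have eq: "trace (A ** w) = trace (A ** v)" if "w \<in> cls v" for w
  proof -
    have "A ** (v - w) \<in> strict_upper"
      using borel_mult_strict_upper[OF assms] that by (simp add: mem_cls)
    then have "trace (A ** (v - w)) = 0" by (simp add: trace_def strict_upper_def)
    then show ?thesis by (simp add: matrix_diff_ldistrib trace_sub)
  qed
  have v: "v \<in> cls v" by (simp add: mem_cls strict_upper_def)
  have "(\<lambda>w. trace (A ** w)) ` cls v = (\<lambda>w. trace (A ** v)) ` cls v"
    by (intro image_cong refl eq)
  also have "\<dots> = {trace (A ** v)}" by (rule image_constant[OF v])
  finally have "(\<lambda>w. trace (A ** w)) ` cls v = {trace (A ** v)}" .
  then show ?thesis by (simp add: trace_dual_def)
qed

lemma moment_cls:
  assumes "r \<in> borel_alg"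
  shows "moment (r, cls v, i, j) = cls (r ** v - v ** r + outer_prod i j)"
proof -
  have "cls (r ** w - w ** r + outer_prod i j) = cls (r ** v - v ** r + outer_prod i j)"
    if "w \<in> cls v" for w
  proof -
    have u: "v - w \<in> strict_upper" using that by (simp add: mem_cls)
    have "r ** (v - w) \<in> strict_upper" "(v - w) ** r \<in> strict_upper"
      using borel_mult_strict_upper[OF assms u] strict_upper_mult_borel[OF assms u] .
    then show ?thesis
      by (auto simp: cls_eq_iff strict_upper_def matrix_diff_ldistrib matrix_diff_rdistrib)
  qed
  moreover have "v \<in> cls v" by (simp add: mem_cls strict_upper_def)
  ultimately show ?thesis unfolding moment_def prod.case by (intro UN_constant_eq ballI)
qed

lemma borel_grp_inverse:
  fixes b :: "('n::{finite,wellorder}) cmat"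
  assumes "b \<in> borel_grp" shows "matrix_inv b \<in> borel_alg"
proof -
  have up: "\<And>k l. l < k \<Longrightarrow> b $ k $ l = 0" and inv: "invertible b"
    using assms by (auto simp: borel_grp_def borel_alg_def)
  have "det b \<noteq> 0" using inv by (simp add: invertible_det_nz)
  then have diag: "b $ k $ k \<noteq> 0" for k
    using det_upperdiagonal[of b] up by auto
  have id: "matrix_inv b ** b = mat 1" 
    using someI_ex[OF inv[unfolded invertible_def]] by (simp add: matrix_inv_def)
  have "matrix_inv b $ k $ l = 0" if "l < k" for k l
    using that
  proof (induction l rule: less_induct)
    case (less l)
    have "0 = (matrix_inv b ** b) $ k $ l" using less.prems by (simp add: id mat_def)
    also have "\<dots> = (\<Sum>m\<in>UNIV. matrix_inv b $ k $ m * b $ m $ l)"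
      by (simp add: matrix_matrix_mult_def)
    also have "\<dots> = (\<Sum>m\<in>{l}. matrix_inv b $ k $ m * b $ m $ l)"
    proof (rule sum.mono_neutral_right)
      show "\<forall>m\<in>UNIV - {l}. matrix_inv b $ k $ m * b $ m $ l = 0"
      proof
        fix m assume "m \<in> UNIV - {l}"
        then consider "m < l" | "l < m" by fastforce
        then show "matrix_inv b $ k $ m * b $ m $ l = 0"
          using less.IH less.prems up by cases (auto dest: less_trans)
      qed
    qed auto
    finally show ?case using diag by simp
  qed
  then show ?thesis by (simp add: borel_alg_def)
qed

lemma act_cls:
  assumes "b \<in> borel_grp"
  shows "act b (r, cls v, i, j) =
    (b ** r ** matrix_inv b, cls (b ** v ** matrix_inv b), b *v i, j v* matrix_inv b)"
proof -
  have b: "b \<in> borel_alg" using assms by (simp add: borel_grp_def)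
  have "cls (b ** w ** matrix_inv b) = cls (b ** v ** matrix_inv b)" if "w \<in> cls v" for w
  proof -
    have u: "v - w \<in> strict_upper" using that by (simp add: mem_cls)
    have "b ** (v - w) ** matrix_inv b \<in> strict_upper"
      using strict_upper_mult_borel[OF borel_grp_inverse[OF assms] borel_mult_strict_upper[OF b u]] .
    then show ?thesis
      by (auto simp: cls_eq_iff strict_upper_def matrix_diff_ldistrib matrix_diff_rdistrib)
  qed
  moreover have "v \<in> cls v" by (simp add: mem_cls strict_upper_def)
  ultimately have "(\<Union>w\<in>cls v. cls (b ** w ** matrix_inv b)) = cls (b ** v ** matrix_inv b)"
    by (intro UN_constant_eq ballI)
  then show ?thesis by (simp only: act_def prod.case)
qed

text \<open>The factors of \<open>lprod\<close> commute, so their order is immaterial.\<close>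

lemma lmat_commute: "lmat r k ** lmat r m = lmat r m ** lmat r k"
proof -
  have l: "(mat c ** A) $ a $ b = c * A $ a $ b" for c a b and A :: "'a cmat"
    unfolding matrix_matrix_mult_def mat_def
    by (simp add: if_distrib[of "\<lambda>x. x * _"] cong: if_cong)
  have r: "(A ** mat c) $ a $ b = c * A $ a $ b" for c a b and A :: "'a cmat"
    unfolding matrix_matrix_mult_def mat_def
    by (simp add: if_distrib[of "\<lambda>x. _ * x"] mult.commute cong: if_cong)
  show ?thesis
    unfolding lmat_def matrix_diff_ldistrib matrix_diff_rdistrib
    by (simp only: vec_eq_iff vector_minus_component l r) (simp add: mat_def)
qed

end

theory Submission
  imports Defs
begin

text \<open>
  Everything rests on one normal form. An upper triangular \<open>r\<close> with distinct eigenvalues is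
  conjugate under \<open>B\<close> to its own diagonal (\<open>borel_diagonalizable\<close>), because an eigenvector for the
  eigenvalue \<open>r\<^bsub>cc\<^esub>\<close> necessarily has its last nonzero coordinate in position \<open>c\<close>. For
  diagonal \<open>r = diag(x)\<close> the moment map equation reads \<open>(x\<^bsub>a\<^esub> - x\<^bsub>b\<^esub>) s\<^bsub>ab\<^esub> + i\<^bsub>a\<^esub> j\<^bsub>b\<^esub> = 0\<close>
  for \<open>b \<le> a\<close>. So \<open>i\<^bsub>a\<^esub> j\<^bsub>a\<^esub> = 0\<close> for every \<open>a\<close>, the entries of \<open>s\<close> below the
  diagonal are determined by \<open>x\<close>, \<open>i\<close> and \<open>j\<close>, and the diagonal of \<open>s\<close> is free.

  The matrix \<open>\<Prod>\<^bsub>k\<noteq>c\<^esub> l\<^bsub>k\<^esub>(r)\<close> is upper triangular and only its \<open>c\<close>-th diagonal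
  entry, \<open>\<Prod>\<^bsub>k\<noteq>c\<^esub> (r\<^bsub>cc\<^esub> - r\<^bsub>kk\<^esub>)\<close>, is nonzero. Hence its trace does not
  vanish and \<open>P\<close> is a quotient of polynomials with a denominator that has no zeros. It is conjugated
  along with \<open>r\<close>, which makes \<open>P\<close> invariant; and for diagonal \<open>r\<close> it is a multiple of the matrix
  unit \<open>E\<^bsub>cc\<^esub>\<close>, so that \<open>P\<close> reads off the diagonals of \<open>r\<close> and \<open>s\<close>. In particular \<open>P\<close>
  maps \<open>(diag(x), diag(y), 0, 0)\<close> to \<open>(x, y)\<close> and is surjective.

  Finally, the closure of the orbit of any \<open>p\<close> with \<open>P(p) = (x, y)\<close> contains the point
  \<open>(diag(x), diag(y), 0, 0)\<close> (\<open>split_point_in_orbit_closure\<close>). After diagonalizing \<open>r\<close>, act by the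
  one-parameter subgroup with entry \<open>\<tau>\<close> where \<open>i\<^bsub>a\<^esub> \<noteq> 0\<close> and \<open>\<tau>\<^sup>-\<^sup>1\<close> elsewhere:
  as \<open>i\<^bsub>a\<^esub> j\<^bsub>a\<^esub> = 0\<close>, it multiplies \<open>i\<close> and \<open>j\<close> by \<open>\<tau>\<close> and the entries of \<open>s\<close>
  below the diagonal by \<open>\<tau>\<^sup>2\<close>, and one lets \<open>\<tau>\<close> tend to \<open>0\<close>. Two orbits with the same value of
  \<open>P\<close> therefore have closures with a common point.
\<close>


section \<open>Triangular and diagonal matrices\<close>

definition diag_mat :: "('n::{finite,wellorder}) cvec \<Rightarrow> 'n cmat" where
  "diag_mat x = (\<chi> a b. if a = b then x $ a else 0)"

lemma diag_mat_nth: "diag_mat x $ a $ b = (if a = b then x $ a else 0)"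
  by (simp add: diag_mat_def)

lemma diag_mat_mult: "(diag_mat x ** A) $ a $ b = x $ a * A $ a $ b"
  unfolding matrix_matrix_mult_def diag_mat_def
  by (simp add: if_distrib[of "\<lambda>x. x * _"] cong: if_cong)

lemma mult_diag_mat: "(A ** diag_mat x) $ a $ b = A $ a $ b * x $ b"
  unfolding matrix_matrix_mult_def diag_mat_def
  by (simp add: if_distrib[of "\<lambda>x. _ * x"] cong: if_cong)

lemma diag_mat_mult_vec: "(diag_mat x *v i) $ a = x $ a * i $ a"
  unfolding matrix_vector_mult_def diag_mat_def
  by (simp add: if_distrib[of "\<lambda>x. x * _"] cong: if_cong)

lemma vec_mult_diag_mat: "(j v* diag_mat x) $ a = j $ a * x $ a"
  unfolding vector_matrix_mult_def diag_mat_def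
  by (simp add: if_distrib[of "\<lambda>x. _ * x"] cong: if_cong)

lemma borel_algD: "A \<in> borel_alg \<Longrightarrow> b < a \<Longrightarrow> A $ a $ b = 0"
  by (simp add: borel_alg_def)

lemma diag_mat_borel: "diag_mat x \<in> borel_alg"
  by (simp add: borel_alg_def diag_mat_def)

lemma borel_mult:
  assumes "A \<in> borel_alg" "B \<in> borel_alg" shows "A ** B \<in> borel_alg"
  unfolding borel_alg_def matrix_matrix_mult_def
proof (clarsimp, intro sum.neutral ballI)
  fix a b k :: 'a assume "b < a"
  show "A $ a $ k * B $ k $ b = 0"
    using assms \<open>b < a\<close> by (cases "k < a") (auto simp: borel_alg_def)
qed

lemma borel_mult_diag:
  assumes "A \<in> borel_alg" "B \<in> borel_alg"
  shows "(A ** B) $ a $ a = A $ a $ a * B $ a $ a"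
proof -
  have "(A ** B) $ a $ a = (\<Sum>k\<in>UNIV. A $ a $ k * B $ k $ a)"
    by (simp add: matrix_matrix_mult_def)
  also have "\<dots> = (\<Sum>k\<in>{a}. A $ a $ k * B $ k $ a)"
  proof (rule sum.mono_neutral_right)
    show "\<forall>k\<in>UNIV - {a}. A $ a $ k * B $ k $ a = 0"
    proof
      fix k assume "k \<in> UNIV - {a}"
      then consider "k < a" | "a < k" by fastforce
      then show "A $ a $ k * B $ k $ a = 0"
        using assms by cases (auto dest: borel_algD)
    qed
  qed auto
  finally show ?thesis by simp
qed

lemma inverse_matrix:
  fixes b :: "('n::{finite,wellorder}) cmat"
  assumes "b \<in> borel_grp"
  shows "matrix_inv b ** b = mat 1" "b ** matrix_inv b = mat 1"
  using someI_ex[of "\<lambda>c. b ** c = mat 1 \<and> c ** b = mat 1"] assms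
  by (auto simp: borel_grp_def invertible_def matrix_inv_def)

lemma matrix_inv_eqI:
  fixes b :: "('n::{finite,wellorder}) cmat"
  assumes "b \<in> borel_grp" "b ** c = mat 1" shows "matrix_inv b = c"
proof -
  have "matrix_inv b = matrix_inv b ** (b ** c)" by (simp add: assms)
  also have "\<dots> = c" by (simp add: matrix_mul_assoc inverse_matrix[OF assms(1)])
  finally show ?thesis .
qed

lemma borel_grp_matrix_inv:
  fixes b :: "('n::{finite,wellorder}) cmat"
  assumes "b \<in> borel_grp" shows "matrix_inv b \<in> borel_grp"
  using borel_grp_inverse[OF assms] inverse_matrix[OF assms]
  by (auto simp: borel_grp_def invertible_def)

lemma matrix_inv_matrix_inv:
  fixes b :: "('n::{finite,wellorder}) cmat"
  assumes "b \<in> borel_grp" shows "matrix_inv (matrix_inv b) = b"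
  using assms by (intro matrix_inv_eqI borel_grp_matrix_inv inverse_matrix)

lemma borel_grp_mult:
  assumes "a \<in> borel_grp" "b \<in> borel_grp" shows "a ** b \<in> borel_grp"
  using assms by (auto simp: borel_grp_def borel_mult invertible_mult)

lemma matrix_inv_mult:
  assumes "a \<in> borel_grp" "b \<in> borel_grp"
  shows "matrix_inv (a ** b) = matrix_inv b ** matrix_inv a"
proof (rule matrix_inv_eqI[OF borel_grp_mult[OF assms]])
  have "a ** b ** (matrix_inv b ** matrix_inv a) = a ** (b ** matrix_inv b) ** matrix_inv a"
    by (simp only: matrix_mul_assoc)
  then show "a ** b ** (matrix_inv b ** matrix_inv a) = mat 1"
    by (simp add: inverse_matrix assms)
qed

lemma borel_grp_iff_diag:
  "b \<in> borel_grp \<longleftrightarrow> b \<in> borel_alg \<and> (\<forall>a. b $ a $ a \<noteq> 0)"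
  using det_upperdiagonal[of b]
  by (auto simp: borel_grp_def invertible_det_nz borel_alg_def)

lemma matrix_inv_diag_mat:
  assumes "\<And>a. t $ a \<noteq> 0"
  shows "diag_mat t \<in> borel_grp" "matrix_inv (diag_mat t) = diag_mat (\<chi> a. inverse (t $ a))"
proof -
  show t: "diag_mat t \<in> borel_grp"
    using assms by (simp add: borel_grp_iff_diag diag_mat_borel diag_mat_nth)
  show "matrix_inv (diag_mat t) = diag_mat (\<chi> a. inverse (t $ a))"
    by (rule matrix_inv_eqI[OF t]) (simp add: vec_eq_iff diag_mat_mult diag_mat_nth mat_def assms)
qed

lemma borel_conj:
  assumes "b \<in> borel_grp" "A \<in> borel_alg"
  shows "b ** A ** matrix_inv b \<in> borel_alg"
  using assms borel_grp_inverse[OF assms(1)] by (auto simp: borel_grp_def intro!: borel_mult)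

lemma strict_upper_conj:
  assumes "b \<in> borel_grp" "A \<in> strict_upper"
  shows "b ** A ** matrix_inv b \<in> strict_upper"
  using assms borel_grp_inverse[OF assms(1)]
  by (intro strict_upper_mult_borel borel_mult_strict_upper) (auto simp: borel_grp_def)

text \<open>Taking the diagonal is multiplicative on triangular matrices, so conjugation by \<open>B\<close> does not
  change it. This is why the diagonal of \<open>r\<close> is an invariant.\<close>

lemma borel_conj_diag:
  assumes "b \<in> borel_grp" "A \<in> borel_alg"
  shows "(b ** A ** matrix_inv b) $ a $ a = A $ a $ a"
proof -
  have b: "b \<in> borel_alg" using assms by (simp add: borel_grp_def)
  have inv: "matrix_inv b \<in> borel_alg" by (rule borel_grp_inverse[OF assms(1)])
  have "b $ a $ a * matrix_inv b $ a $ a = 1"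
    using borel_mult_diag[OF b inv, of a] by (simp add: inverse_matrix[OF assms(1)] mat_def)
  then show ?thesis
    by (simp add: borel_mult_diag borel_mult b inv assms mult.commute mult.left_commute)
qed

lemma conj_mult:
  assumes "b \<in> borel_grp"
  shows "(b ** A ** matrix_inv b) ** (b ** C ** matrix_inv b) = b ** (A ** C) ** matrix_inv b"
proof -
  have "(b ** A ** matrix_inv b) ** (b ** C ** matrix_inv b)
      = b ** A ** (matrix_inv b ** b) ** C ** matrix_inv b"
    by (simp only: matrix_mul_assoc)
  then show ?thesis by (simp add: inverse_matrix[OF assms] matrix_mul_assoc)
qed

lemma trace_conj:
  assumes "b \<in> borel_grp"
  shows "trace (b ** A ** matrix_inv b) = trace A"
proof -
  have "trace (b ** A ** matrix_inv b) = trace (matrix_inv b ** (b ** A))"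
    by (rule trace_mul_sym)
  then show ?thesis by (simp add: matrix_mul_assoc inverse_matrix[OF assms])
qed


section \<open>Eigenvalues and diagonalization\<close>

text \<open>Since \<open>r\<close> is triangular, the row of \<open>r *v v = c *s v\<close> at the last nonzero coordinate of \<open>v\<close>
  involves a single diagonal entry.\<close>

lemma triangular_eigenvector:
  assumes r: "r \<in> borel_alg" and v: "v \<noteq> 0" "r *v v = c *s v"
  obtains a where "r $ a $ a = c" "v $ a \<noteq> 0" "\<And>k. a < k \<Longrightarrow> v $ k = 0"
proof -
  define S where "S = {k. v $ k \<noteq> 0}"
  have S: "finite S" "S \<noteq> {}" using v(1) by (auto simp: S_def vec_eq_iff)
  define a where "a = Max S"
  have a: "v $ a \<noteq> 0" using Max_in[OF S] by (simp add: a_def S_def)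
  have gt: "v $ k = 0" if "a < k" for k
  proof -
    have "k \<notin> S" using Max_ge[OF S(1), of k] that by (auto simp: a_def not_le[symmetric])
    then show ?thesis by (simp add: S_def)
  qed
  have "c * v $ a = (r *v v) $ a" by (simp add: v(2))
  also have "\<dots> = (\<Sum>k\<in>UNIV. r $ a $ k * v $ k)" by (simp add: matrix_vector_mult_def)
  also have "\<dots> = (\<Sum>k\<in>{a}. r $ a $ k * v $ k)"
  proof (rule sum.mono_neutral_right)
    show "\<forall>k\<in>UNIV - {a}. r $ a $ k * v $ k = 0"
    proof
      fix k assume "k \<in> UNIV - {a}"
      then consider "k < a" | "a < k" by fastforce
      then show "r $ a $ k * v $ k = 0"
        using borel_algD[OF r] gt by cases auto
    qed
  qed auto
  finally have "r $ a $ a = c" using a by simp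
  then show ?thesis using that a gt by blast
qed

text \<open>The triangular matrix \<open>l\<^bsub>c\<^esub>(r)\<close> has a zero on its diagonal, so it is singular.\<close>

lemma triangular_eigenvector_exists:
  assumes r: "r \<in> borel_alg"
  obtains v where "v \<noteq> 0" "r *v v = r $ c $ c *s v"
proof -
  have "det (lmat r c) = (\<Prod>a\<in>UNIV. lmat r c $ a $ a)"
    using borel_algD[OF r] by (intro det_upperdiagonal) (auto simp: lmat_def mat_def)
  also have "\<dots> = 0" by (rule prod_zero) (auto simp: lmat_def mat_def)
  finally have "\<not> invertible (lmat r c)" by (simp add: invertible_det_nz)
  then obtain v where v: "v \<noteq> 0" "lmat r c *v v = 0"
    unfolding invertible_left_inverse matrix_left_invertible_ker by blast
  have "mat (r $ c $ c) *v v = r $ c $ c *s v"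
    unfolding vec_eq_iff matrix_vector_mult_def mat_def
    by (simp add: if_distrib[of "\<lambda>x. x * _"] cong: if_cong)
  then have "r *v v = r $ c $ c *s v"
    using v(2) by (simp add: lmat_def matrix_vector_mult_diff_rdistrib)
  then show ?thesis using that v by blast
qed

lemma eigenvalues_triangular:
  assumes "r \<in> borel_alg" shows "eigenvalues r = range (\<lambda>a. r $ a $ a)"
proof
  show "eigenvalues r \<subseteq> range (\<lambda>a. r $ a $ a)"
    by (auto simp: eigenvalues_def elim!: triangular_eigenvector[OF assms])
  show "range (\<lambda>a. r $ a $ a) \<subseteq> eigenvalues r"
    by (auto simp: eigenvalues_def intro: triangular_eigenvector_exists[OF assms])
qed

lemma card_eigenvalues_triangular:
  fixes r :: "('n::{finite,wellorder}) cmat"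
  assumes "r \<in> borel_alg"
  shows "card (eigenvalues r) = CARD('n) \<longleftrightarrow> inj (\<lambda>a. r $ a $ a)"
  unfolding eigenvalues_triangular[OF assms] by (simp add: inj_on_iff_eq_card)

text \<open>Take an eigenvector for each \<open>r\<^bsub>cc\<^esub>\<close> as column \<open>c\<close> of a matrix. As the diagonal entries of
  \<open>r\<close> differ, its last nonzero coordinate has to be the \<open>c\<close>-th one, so this matrix already lies in
  \<open>B\<close>.\<close>

lemma borel_diagonalizable:
  assumes r: "r \<in> borel_alg" and dist: "inj (\<lambda>a. r $ a $ a)"
  obtains b where "b \<in> borel_grp" "b ** r ** matrix_inv b = diag_mat (\<chi> a. r $ a $ a)"
proof -
  have "\<exists>v. r *v v = r $ c $ c *s v \<and> v $ c \<noteq> 0 \<and> (\<forall>k>c. v $ k = 0)" for c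
  proof -
    obtain v where v: "v \<noteq> 0" "r *v v = r $ c $ c *s v"
      using triangular_eigenvector_exists[OF r] .
    obtain a where a: "r $ a $ a = r $ c $ c" "v $ a \<noteq> 0" "\<And>k. a < k \<Longrightarrow> v $ k = 0"
      using triangular_eigenvector[OF r v] by blast
    have "a = c" using injD[OF dist] a(1) by simp
    then show ?thesis using a v by blast
  qed
  then obtain v where v: "\<And>c. r *v v c = r $ c $ c *s v c" "\<And>c. v c $ c \<noteq> 0"
    "\<And>c k. c < k \<Longrightarrow> v c $ k = 0" by metis
  define e where "e = (\<chi> a c. v c $ a)"
  have e: "e \<in> borel_grp"
    by (simp add: borel_grp_iff_diag borel_alg_def e_def v)
  have re: "r ** e = e ** diag_mat (\<chi> a. r $ a $ a)"
  proof -
    have "(r ** e) $ a $ c = (r *v v c) $ a" for a c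
      by (simp add: matrix_matrix_mult_def matrix_vector_mult_def e_def)
    then show ?thesis by (simp add: vec_eq_iff mult_diag_mat v(1) e_def)
  qed
  have "matrix_inv e ** r ** e = matrix_inv e ** (r ** e)" by (simp add: matrix_mul_assoc)
  also have "\<dots> = diag_mat (\<chi> a. r $ a $ a)"
    unfolding re by (simp add: matrix_mul_assoc inverse_matrix[OF e])
  finally show ?thesis
    using that[OF borel_grp_matrix_inv[OF e]] by (simp add: matrix_inv_matrix_inv[OF e])
qed


section \<open>The products of the factors \<open>l\<^bsub>k\<^esub>(r)\<close>\<close>

lemma lprod_borel:
  assumes r: "r \<in> borel_alg"
  shows "lprod r c \<in> borel_alg" (is ?borel)
    and "lprod r c $ a $ a = (\<Prod>k\<in>UNIV - {c}. r $ a $ a - r $ k $ k)" (is ?diag)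
proof -
  have l: "lmat r k \<in> borel_alg" for k
    using r by (simp add: borel_alg_def lmat_def mat_def)
  have one: "mat 1 \<in> borel_alg" by (simp add: borel_alg_def mat_def)
  have fold: "foldr (\<lambda>k M. lmat r k ** M) L (mat 1) \<in> borel_alg \<and>
    foldr (\<lambda>k M. lmat r k ** M) L (mat 1) $ a $ a = prod_list (map (\<lambda>k. r $ a $ a - r $ k $ k) L)"
    for L
    by (induction L) (auto simp: one borel_mult borel_mult_diag l, auto simp: lmat_def mat_def)
  show ?borel unfolding lprod_def using fold by blast
  show ?diag
    unfolding lprod_def
    using fold prod.distinct_set_conv_list[of "sorted_list_of_set (UNIV - {c})", symmetric]
    by simp
qed

text \<open>At a position \<open>a \<noteq> c\<close> the diagonal entry of the product has the vanishing factor with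
  \<open>k = a\<close>.\<close>

lemma trace_lprod:
  assumes r: "r \<in> borel_alg"
  shows "trace (lprod r c) = (\<Prod>k\<in>UNIV - {c}. r $ c $ c - r $ k $ k)"
proof -
  have "lprod r c $ a $ a = 0" if "a \<noteq> c" for a
    unfolding lprod_borel(2)[OF r] using that by (intro prod_zero) auto
  then have "trace (lprod r c) = (\<Sum>a\<in>{c}. lprod r c $ a $ a)"
    unfolding trace_def by (intro sum.mono_neutral_right) auto
  then show ?thesis by (simp add: lprod_borel(2)[OF r])
qed

lemma trace_lprod_nonzero:
  assumes "r \<in> borel_alg" "inj (\<lambda>a. r $ a $ a)" shows "trace (lprod r c) \<noteq> 0"
  using assms by (auto simp: trace_lprod dest: injD[of "\<lambda>a. r $ a $ a" c])

text \<open>Each factor is conjugated along with \<open>r\<close>, since the scalar \<open>r\<^bsub>kk\<^esub>\<close> in \<open>l\<^bsub>k\<^esub>(r)\<close> is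
  unchanged by \<open>borel_conj_diag\<close>.\<close>

lemma lprod_conj:
  assumes b: "b \<in> borel_grp" and r: "r \<in> borel_alg"
  shows "lprod (b ** r ** matrix_inv b) c = b ** lprod r c ** matrix_inv b"
proof -
  have comm: "b ** mat x = mat x ** b" for x
    unfolding matrix_matrix_mult_def mat_def vec_eq_iff
    by (simp add: if_distrib[of "\<lambda>x. _ * x"] if_distrib[of "\<lambda>x. x * _"] mult.commute cong: if_cong)
  have "b ** mat x ** matrix_inv b = mat x" for x
    unfolding comm matrix_mul_assoc[symmetric] by (simp add: inverse_matrix[OF b])
  then have l: "lmat (b ** r ** matrix_inv b) k = b ** lmat r k ** matrix_inv b" for k
    by (simp add: lmat_def borel_conj_diag[OF b r] matrix_diff_ldistrib matrix_diff_rdistrib)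
  have "foldr (\<lambda>k M. lmat (b ** r ** matrix_inv b) k ** M) L (mat 1)
    = b ** foldr (\<lambda>k M. lmat r k ** M) L (mat 1) ** matrix_inv b" for L
    by (induction L) (simp_all add: inverse_matrix[OF b] l conj_mult[OF b])
  then show ?thesis by (simp add: lprod_def)
qed

lemma lprod_diag_mat:
  "lprod (diag_mat x) c $ a $ b =
    (if a = c \<and> b = c then trace (lprod (diag_mat x) c) else 0)"
proof -
  have l: "lmat (diag_mat x) k = diag_mat (\<chi> a. x $ a - x $ k)" for k
    by (simp add: vec_eq_iff lmat_def diag_mat_nth mat_def)
  have "a \<noteq> b \<longrightarrow> foldr (\<lambda>k M. lmat (diag_mat x) k ** M) L (mat 1) $ a $ b = 0" for L
    by (induction L) (auto simp: mat_def l diag_mat_mult)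
  then have off: "a \<noteq> b \<Longrightarrow> lprod (diag_mat x) c $ a $ b = 0" by (simp add: lprod_def)
  have "lprod (diag_mat x) c $ a $ a = 0" if "a \<noteq> c"
    unfolding lprod_borel(2)[OF diag_mat_borel] using that by (intro prod_zero) auto
  moreover have "lprod (diag_mat x) c $ c $ c = trace (lprod (diag_mat x) c)"
    by (simp only: trace_lprod[OF diag_mat_borel] lprod_borel(2)[OF diag_mat_borel])
  ultimately show ?thesis using off by (cases "a = b") auto
qed


section \<open>The action on the zero fibre and the values of the map\<close>

lemma mem_zero_fibre_rss:
  "(r, cls v, i, j) \<in> zero_fibre_rss \<longleftrightarrow> r \<in> borel_alg \<and>
    r ** v - v ** r + outer_prod i j \<in> strict_upper \<and> inj (\<lambda>a. r $ a $ a)"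
proof -
  have "cls w = cls 0 \<longleftrightarrow> w \<in> strict_upper" for w :: "'a cmat" by (simp add: cls_eq_iff)
  then show ?thesis
    by (cases "r \<in> borel_alg")
      (simp_all add: zero_fibre_rss_def cotangent_def borel_dual_eq moment_cls
        card_eigenvalues_triangular)
qed

lemma zero_fibre_rssE:
  assumes "p \<in> zero_fibre_rss"
  obtains r v i j where "p = (r, cls v, i, j)" "r \<in> borel_alg" "inj (\<lambda>a. r $ a $ a)"
    "r ** v - v ** r + outer_prod i j \<in> strict_upper"
proof -
  obtain r v i j where p: "p = (r, cls v, i, j)"
    using assms by (auto simp: zero_fibre_rss_def cotangent_def borel_dual_eq)
  then show ?thesis using that assms by (auto simp: mem_zero_fibre_rss)
qed

lemma matrix_add_rdistrib:
  fixes A :: "('n::{finite,wellorder}) cmat"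
  shows "(B + C) ** A = B ** A + C ** A"
  unfolding vec_eq_iff matrix_matrix_mult_def by (simp_all add: sum.distrib algebra_simps)

lemma Pmap_cls:
  assumes "r \<in> borel_alg"
  shows "Pmap (r, cls v, i, j) = (\<chi> c. r $ c $ c,
    \<chi> c. inverse (trace (lprod r c)) * trace (lprod r c ** v))"
  by (simp add: Pmap_def sdiag_def trace_dual_cls lprod_borel assms)

lemma outer_prod_conj:
  "outer_prod (b *v i) (j v* c) = b ** outer_prod i j ** c"
  unfolding vec_eq_iff outer_prod_def matrix_matrix_mult_def matrix_vector_mult_def
    vector_matrix_mult_def
  by (auto simp: sum_distrib_left sum_distrib_right mult.assoc intro!: sum.swap sum.cong)

lemma act_zero_fibre_rss:
  assumes b: "b \<in> borel_grp" and p: "p \<in> zero_fibre_rss"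
  shows "act b p \<in> zero_fibre_rss"
proof -
  obtain r v i j where rv: "p = (r, cls v, i, j)" "r \<in> borel_alg" "inj (\<lambda>a. r $ a $ a)"
    "r ** v - v ** r + outer_prod i j \<in> strict_upper" using p by (rule zero_fibre_rssE)
  have "b ** (r ** v - v ** r + outer_prod i j) ** matrix_inv b \<in> strict_upper"
    by (rule strict_upper_conj[OF b rv(4)])
  then show ?thesis
    unfolding rv(1) act_cls[OF b] mem_zero_fibre_rss
    by (simp add: borel_conj[OF b] borel_conj_diag[OF b] rv conj_mult[OF b] outer_prod_conj
        matrix_diff_ldistrib matrix_diff_rdistrib matrix_add_ldistrib matrix_add_rdistrib)
qed

text \<open>Both traces in \<open>P\<close> are traces of matrices that the action conjugates.\<close>

lemma Pmap_act:
  assumes b: "b \<in> borel_grp" and p: "p \<in> zero_fibre_rss"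
  shows "Pmap (act b p) = Pmap p"
proof -
  obtain r v i j where rv: "p = (r, cls v, i, j)" "r \<in> borel_alg"
    using p by (rule zero_fibre_rssE)
  show ?thesis
    unfolding rv(1) act_cls[OF b]
    by (simp add: Pmap_cls borel_conj[OF b] borel_conj_diag[OF b] rv lprod_conj[OF b]
        conj_mult[OF b] trace_conj[OF b])
qed

lemma act_act:
  assumes "a \<in> borel_grp" "b \<in> borel_grp" "p \<in> cotangent"
  shows "act a (act b p) = act (a ** b) p"
proof -
  obtain r v i j where p: "p = (r, cls v, i, j)"
    using assms(3) by (auto simp: cotangent_def borel_dual_eq)
  show ?thesis
    unfolding p by (simp add: act_cls borel_grp_mult matrix_inv_mult assms matrix_mul_assoc
        matrix_vector_mul_assoc vector_matrix_mul_assoc)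
qed

lemma orbit_act_subset:
  assumes "b \<in> borel_grp" "p \<in> cotangent"
  shows "orbit (act b p) \<subseteq> orbit p"
  using assms by (auto simp: orbit_def act_act borel_grp_mult)

lemma zero_fibre_rss_cotangent: "zero_fibre_rss \<subseteq> cotangent"
  by (auto simp: zero_fibre_rss_def)

lemma orbit_subset_zero_fibre_rss: "p \<in> zero_fibre_rss \<Longrightarrow> orbit p \<subseteq> zero_fibre_rss"
  by (auto simp: orbit_def act_zero_fibre_rss)

lemma Pmap_diag_mat:
  assumes x: "inj (\<lambda>a. x $ a)"
  shows "Pmap (diag_mat x, cls v, i, j) = (x, \<chi> a. v $ a $ a)"
proof -
  have "trace (lprod (diag_mat x) c ** v) = trace (lprod (diag_mat x) c) * v $ c $ c" for c
  proof -
    have "(lprod (diag_mat x) c ** v) $ a $ a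
      = (if a = c then trace (lprod (diag_mat x) c) * v $ c $ c else 0)" for a
      by (simp add: matrix_matrix_mult_def lprod_diag_mat if_distrib[of "\<lambda>x. x * _"]
          cong: if_cong)
    then show ?thesis by (simp add: trace_def[of "_ ** _"])
  qed
  moreover have "trace (lprod (diag_mat x) c) \<noteq> 0" for c
    using x by (intro trace_lprod_nonzero diag_mat_borel) (simp add: diag_mat_nth)
  ultimately show ?thesis
    by (simp add: Pmap_cls diag_mat_borel vec_eq_iff diag_mat_nth)
qed

text \<open>This point is a preimage of \<open>(x, y)\<close> under \<open>P\<close>, and it lies in the closure of the orbit of every
  other preimage by \<open>split_point_in_orbit_closure\<close>.\<close>

definition split_point :: "('n::{finite,wellorder}) cvec \<times> 'n cvec \<Rightarrow> 'n point" where
  "split_point = (\<lambda>(x, y). (diag_mat x, cls (diag_mat y), 0, 0))"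

lemma config_iff: "(x, y) \<in> config \<longleftrightarrow> inj (\<lambda>a. x $ a)"
  by (auto simp: config_def inj_def)

lemma split_point_zero_fibre_rss:
  assumes "z \<in> config" shows "split_point z \<in> zero_fibre_rss"
proof -
  obtain x y where z: "z = (x, y)" by fastforce
  have "diag_mat x ** diag_mat y - diag_mat y ** diag_mat x + outer_prod 0 0 = 0"
    by (simp add: vec_eq_iff diag_mat_mult diag_mat_nth outer_prod_def)
  then show ?thesis
    using assms by (simp add: z split_point_def mem_zero_fibre_rss diag_mat_borel config_iff
        diag_mat_nth strict_upper_def)
qed

lemma Pmap_split_point:
  assumes "z \<in> config" shows "Pmap (split_point z) = z"
  using assms by (cases z) (simp add: split_point_def Pmap_diag_mat config_iff diag_mat_nth vec_eq_iff)

lemma Pmap_config: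
  assumes "p \<in> zero_fibre_rss" shows "Pmap p \<in> config"
proof -
  obtain r v i j where "p = (r, cls v, i, j)" "r \<in> borel_alg" "inj (\<lambda>a. r $ a $ a)"
    using assms by (rule zero_fibre_rssE)
  then show ?thesis by (simp add: Pmap_cls config_iff)
qed


section \<open>Regularity\<close>

lemma poly_funs_sum:
  assumes "\<And>k. k \<in> A \<Longrightarrow> f k \<in> poly_funs C"
  shows "(\<lambda>p. \<Sum>k\<in>A. f k p) \<in> poly_funs C"
  using assms by (induction A rule: infinite_finite_induct) (auto intro: poly_funs.const poly_funs.add)

lemma poly_funs_diff:
  assumes "f \<in> poly_funs C" "g \<in> poly_funs C"
  shows "(\<lambda>p. f p - g p) \<in> poly_funs C"
  using poly_funs.add[OF assms(1) poly_funs.mult[OF poly_funs.const[of "-1"] assms(2)]] by simp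

definition poly_mat :: "('p \<Rightarrow> complex) set \<Rightarrow> ('p \<Rightarrow> ('n::{finite,wellorder}) cmat) \<Rightarrow> bool" where
  "poly_mat C M \<longleftrightarrow> (\<forall>a b. (\<lambda>p. M p $ a $ b) \<in> poly_funs C)"

lemma poly_mat_mult:
  assumes "poly_mat C M" "poly_mat C N" shows "poly_mat C (\<lambda>p. M p ** N p)"
  using assms by (auto simp: poly_mat_def matrix_matrix_mult_def intro!: poly_funs_sum poly_funs.mult)

lemma poly_mat_const: "poly_mat C (\<lambda>_. A)"
  by (simp add: poly_mat_def poly_funs.const)

lemma trace_poly_mat: "poly_mat C M \<Longrightarrow> (\<lambda>p. trace (M p)) \<in> poly_funs C"
  by (simp add: poly_mat_def trace_def poly_funs_sum)

lemma poly_mat_lprod: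
  assumes "poly_mat C M" shows "poly_mat C (\<lambda>p. lprod (M p) c)"
proof -
  have "(\<lambda>p. lmat (M p) k $ a $ b) \<in> poly_funs C" for k a b
    using assms by (cases "a = b")
      (auto simp: poly_mat_def lmat_def mat_def intro!: poly_funs_diff poly_funs.const)
  then have l: "poly_mat C (\<lambda>p. lmat (M p) k)" for k by (simp add: poly_mat_def)
  have "poly_mat C (\<lambda>p. foldr (\<lambda>k N. lmat (M p) k ** N) L (mat 1))" for L
    by (induction L) (simp_all add: poly_mat_const poly_mat_mult l)
  then show ?thesis by (simp add: lprod_def)
qed

lemma regular_fun_quotient:
  assumes "g \<in> poly_funs C" "h \<in> poly_funs C" "\<And>q. q \<in> X \<Longrightarrow> h q \<noteq> 0 \<and> f q = g q / h q"
  shows "regular_fun C X f"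
proof -
  have "openin (zariski C X) X" using openin_topspace[of "zariski C X"] by (simp add: topspace_zariski)
  then show ?thesis unfolding regular_fun_def using assms by blast
qed

text \<open>The coordinates of \<open>\<bb> \<times> \<bb>\<^sup>*\<close> are the upper triangular part of \<open>r\<close> and the lower triangular
  representative of \<open>s\<close>, so these two matrices, rather than \<open>r\<close> and an arbitrary representative, are
  the ones that depend polynomially on an arbitrary point; on \<open>\<mu>\<^sup>-\<^sup>1(0)\<close> they give the same
  traces.\<close>

lemma regular_map_Pmap: "regular_map cotangent_coords zero_fibre_rss config_coords config Pmap"
  unfolding regular_map_def
proof (intro conjI ballI)
  show "Pmap ` zero_fibre_rss \<subseteq> config" using Pmap_config by blast
next
  fix d :: "'a cvec \<times> 'a cvec \<Rightarrow> complex" assume d: "d \<in> config_coords"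
  define R :: "'a point \<Rightarrow> 'a cmat" where
    "R = (\<lambda>(r, S, i, j). \<chi> a b. if a \<le> b then r $ a $ b else 0)"
  define L :: "'a point \<Rightarrow> 'a cmat" where
    "L = (\<lambda>(r, S, i, j). \<chi> a b. if b \<le> a then lower_rep S $ a $ b else 0)"
  have R: "poly_mat cotangent_coords R"
    unfolding poly_mat_def
  proof (intro allI)
    fix a b
    show "(\<lambda>p. R p $ a $ b) \<in> poly_funs cotangent_coords"
    proof (cases "a \<le> b")
      case True
      then have "(\<lambda>(r, S, i, j). r $ a $ b) \<in> cotangent_coords"
        by (auto simp: cotangent_coords_def)
      then show ?thesis using True by (auto simp: R_def case_prod_unfold dest: poly_funs.coord)
    qed (simp add: R_def case_prod_unfold poly_funs.const)
  qed
  have L: "poly_mat cotangent_coords L"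
    unfolding poly_mat_def
  proof (intro allI)
    fix a b
    show "(\<lambda>p. L p $ a $ b) \<in> poly_funs cotangent_coords"
    proof (cases "b \<le> a")
      case True
      then have "(\<lambda>(r, S, i, j). lower_rep S $ a $ b) \<in> cotangent_coords"
        by (auto simp: cotangent_coords_def)
      then show ?thesis using True by (auto simp: L_def case_prod_unfold dest: poly_funs.coord)
    qed (simp add: L_def case_prod_unfold poly_funs.const)
  qed
  have on_fibre: "R (r, cls v, i, j) = r" "trace (lprod r c ** L (r, cls v, i, j)) = trace (lprod r c ** v)"
    if r: "r \<in> borel_alg" for r v c and i j :: "'a cvec"
  proof -
    show "R (r, cls v, i, j) = r" using r by (auto simp: R_def vec_eq_iff borel_alg_def)
    have "cls (L (r, cls v, i, j)) = cls v"
      by (simp add: L_def cls_eq_iff lower_rep_cls strict_upper_def)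
    then show "trace (lprod r c ** L (r, cls v, i, j)) = trace (lprod r c ** v)"
      using trace_dual_cls[OF lprod_borel(1)[OF r]] by metis
  qed
  consider a where "d = (\<lambda>(x, y). x $ a)" | a where "d = (\<lambda>(x, y). y $ a)"
    using d by (auto simp: config_coords_def)
  then show "regular_fun cotangent_coords zero_fibre_rss (\<lambda>p. d (Pmap p))"
  proof cases
    case (1 a)
    show ?thesis
    proof (rule regular_fun_quotient)
      show "(\<lambda>p. R p $ a $ a) \<in> poly_funs cotangent_coords" using R by (simp add: poly_mat_def)
      show "(\<lambda>_. 1) \<in> poly_funs cotangent_coords" by (rule poly_funs.const)
      show "(1::complex) \<noteq> 0 \<and> d (Pmap q) = R q $ a $ a / 1" if "q \<in> zero_fibre_rss" for q
        using that by (auto simp: 1 Pmap_cls on_fibre elim!: zero_fibre_rssE)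
    qed
  next
    case (2 a)
    show ?thesis
    proof (rule regular_fun_quotient)
      show "(\<lambda>p. trace (lprod (R p) a ** L p)) \<in> poly_funs cotangent_coords"
        by (intro trace_poly_mat poly_mat_mult poly_mat_lprod R L)
      show "(\<lambda>p. trace (lprod (R p) a)) \<in> poly_funs cotangent_coords"
        by (intro trace_poly_mat poly_mat_lprod R)
      show "trace (lprod (R q) a) \<noteq> 0 \<and> d (Pmap q) = trace (lprod (R q) a ** L q) / trace (lprod (R q) a)"
        if "q \<in> zero_fibre_rss" for q
        using that
        by (auto simp: 2 Pmap_cls on_fibre trace_lprod_nonzero divide_inverse mult.commute
            elim!: zero_fibre_rssE)
    qed
  qed
qed


section \<open>Orbit closures\<close>

lemma zariski_closure_ofI:
  assumes "q \<in> X" "A \<subseteq> X" "\<And>f. f \<in> poly_funs C \<Longrightarrow> (\<And>p. p \<in> A \<Longrightarrow> f p = 0) \<Longrightarrow> f q = 0"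
  shows "q \<in> zariski C X closure_of A"
  unfolding in_closure_of topspace_zariski
proof (intro conjI allI impI)
  fix T assume "q \<in> T \<and> openin (zariski C X) T"
  then obtain F where F: "F \<subseteq> poly_funs C" "T = X - {p \<in> X. \<forall>f\<in>F. f p = 0}" "q \<in> T"
    by (auto simp: openin_zariski)
  then obtain f where f: "f \<in> F" "f q \<noteq> 0" by auto
  then obtain p where "p \<in> A" "f p \<noteq> 0" using assms(3) F(1) by blast
  then show "\<exists>y. y \<in> A \<and> y \<in> T" using F(2) f assms(2) by blast
qed (rule assms(1))

text \<open>A polynomial function restricts to a continuous function on a curve with continuous
  coordinates, so if it vanishes for \<open>\<tau> \<noteq> 0\<close> then also for \<open>\<tau> = 0\<close>.\<close>

lemma curve_limit_in_zariski_closure: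
  fixes \<gamma> :: "complex \<Rightarrow> 'p"
  assumes "\<gamma> 0 \<in> X" "A \<subseteq> X" and A: "\<And>\<tau>. \<tau> \<noteq> 0 \<Longrightarrow> \<gamma> \<tau> \<in> A"
    and cont: "\<And>f. f \<in> C \<Longrightarrow> isCont (\<lambda>\<tau>. f (\<gamma> \<tau>)) 0"
  shows "\<gamma> 0 \<in> zariski C X closure_of A"
proof (rule zariski_closure_ofI[OF assms(1,2)])
  fix f assume f: "f \<in> poly_funs C" and zero: "\<And>p. p \<in> A \<Longrightarrow> f p = 0"
  from f have "isCont (\<lambda>\<tau>. f (\<gamma> \<tau>)) 0"
    by induction (auto intro: cont)
  then have lim: "((\<lambda>\<tau>. f (\<gamma> \<tau>)) \<longlongrightarrow> f (\<gamma> 0)) (at 0)" by (simp add: isCont_def)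
  have "((\<lambda>\<tau>. f (\<gamma> \<tau>)) \<longlongrightarrow> 0) (at 0)"
    by (rule tendsto_eventually) (auto simp: eventually_at_filter zero A)
  then show "f (\<gamma> 0) = 0" using tendsto_unique[OF _ lim] by simp
qed

lemma diag_mat_moment:
  assumes "diag_mat x ** v - v ** diag_mat x + outer_prod i j \<in> strict_upper" "b \<le> a"
  shows "(x $ a - x $ b) * v $ a $ b + i $ a * j $ b = 0"
  using assms by (auto simp: strict_upper_def diag_mat_mult mult_diag_mat outer_prod_def algebra_simps)

text \<open>The torus of diagonal matrices fixes \<open>diag(x)\<close> and the diagonal of \<open>s\<close>. By the moment map
  equation a suitable one-parameter subgroup contracts \<open>i\<close>, \<open>j\<close> and the rest of \<open>s\<close> to zero at the
  same time.\<close>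

lemma diagonal_point_orbit_closure:
  assumes p: "(diag_mat x, cls v, i, j) \<in> zero_fibre_rss" (is "?p \<in> _")
  shows "split_point (x, \<chi> a. v $ a $ a) \<in> zariski cotangent_coords zero_fibre_rss closure_of orbit ?p"
proof -
  have x: "inj (\<lambda>a. x $ a)"
    and mom: "\<And>a b. b \<le> a \<Longrightarrow> (x $ a - x $ b) * v $ a $ b + i $ a * j $ b = 0"
    using p diag_mat_moment by (auto simp: mem_zero_fibre_rss diag_mat_nth)
  have ij: "i $ a = 0 \<or> j $ a = 0" for a using mom[of a a] by simp
  have v: "v $ a $ b = 0" if "b < a" "i $ a = 0 \<or> j $ b = 0" for a b
    using mom[OF less_imp_le[OF that(1)]] that injD[OF x, of a b] by auto
  define w where "w \<tau> = (\<chi> a b. if a = b then v $ a $ a else if b < a then \<tau>\<^sup>2 * v $ a $ b else 0)"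
    for \<tau>
  define \<gamma> where "\<gamma> \<tau> = (diag_mat x, cls (w \<tau>), \<tau> *s i, \<tau> *s j)" for \<tau>
  have \<gamma>0: "\<gamma> 0 = split_point (x, \<chi> a. v $ a $ a)"
    by (auto simp: \<gamma>_def w_def split_point_def diag_mat_def cls_eq_iff strict_upper_def)
  have in_orbit: "\<gamma> \<tau> \<in> orbit ?p" if \<tau>: "\<tau> \<noteq> 0" for \<tau>
  proof -
    \<comment> \<open>The exponents \<open>1\<close> and \<open>-1\<close> make every coordinate of \<open>i\<close> and \<open>j\<close> that is not zero scale by
      \<open>\<tau>\<close>; an entry of \<open>s\<close> below the diagonal is a multiple of \<open>i\<^bsub>a\<^esub> j\<^bsub>b\<^esub>\<close>, hence scales by \<open>\<tau>\<^sup>2\<close>.\<close>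
    define t where "t = (\<chi> a. if i $ a \<noteq> 0 then \<tau> else inverse \<tau>)"
    have t: "t $ a \<noteq> 0" for a using \<tau> by (simp add: t_def)
    note T = matrix_inv_diag_mat[of t, OF t]
    have "diag_mat t ** diag_mat x ** matrix_inv (diag_mat t) = diag_mat x"
      by (simp add: T(2) vec_eq_iff mult_diag_mat diag_mat_mult diag_mat_nth t)
    moreover have "cls (diag_mat t ** v ** matrix_inv (diag_mat t)) = cls (w \<tau>)"
    proof -
      have "t $ a * v $ a $ b * inverse (t $ b) = w \<tau> $ a $ b" if "b \<le> a" for a b
      proof (cases "a = b")
        case False
        with that have "b < a" by simp
        then show ?thesis
          using v[of b a] ij[of b] False
          by (cases "i $ a = 0 \<or> j $ b = 0") (auto simp: w_def t_def power2_eq_square)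
      qed (simp add: w_def t)
      then show ?thesis
        by (simp add: cls_eq_iff strict_upper_def T(2) mult_diag_mat diag_mat_mult)
    qed
    moreover have "diag_mat t *v i = \<tau> *s i"
      by (simp add: vec_eq_iff diag_mat_mult_vec t_def)
    moreover have "j v* matrix_inv (diag_mat t) = \<tau> *s j"
    proof -
      have "j $ a * inverse (t $ a) = \<tau> * j $ a" for a
        using ij[of a] by (auto simp: t_def)
      then show ?thesis by (simp add: T(2) vec_eq_iff vec_mult_diag_mat)
    qed
    ultimately have "act (diag_mat t) ?p = \<gamma> \<tau>" by (simp add: act_cls[OF T(1)] \<gamma>_def)
    then show ?thesis unfolding orbit_def using T(1) by (auto intro: sym)
  qed
  have "\<gamma> 0 \<in> zariski cotangent_coords zero_fibre_rss closure_of orbit ?p"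
  proof (rule curve_limit_in_zariski_closure)
    show "\<gamma> 0 \<in> zero_fibre_rss"
      unfolding \<gamma>0 by (rule split_point_zero_fibre_rss) (simp add: config_iff x)
    show "orbit ?p \<subseteq> zero_fibre_rss" by (rule orbit_subset_zero_fibre_rss[OF p])
    show "isCont (\<lambda>\<tau>. f (\<gamma> \<tau>)) 0" if "f \<in> cotangent_coords" for f
    proof -
      have "isCont (\<lambda>\<tau>. w \<tau> $ a $ b) 0" for a b
        by (cases "a = b"; cases "b < a") (simp_all add: w_def)
      then show ?thesis
        using that by (auto simp: cotangent_coords_def \<gamma>_def lower_rep_cls)
    qed
  qed (rule in_orbit)
  then show ?thesis by (simp only: \<gamma>0)
qed

text \<open>Diagonalizing \<open>r\<close> changes neither the orbit nor the value of \<open>P\<close>, which reduces the claim to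
  diagonal \<open>r\<close>.\<close>

lemma split_point_in_orbit_closure:
  assumes p: "p \<in> zero_fibre_rss"
  shows "split_point (Pmap p) \<in> zariski cotangent_coords zero_fibre_rss closure_of orbit p"
proof -
  obtain r v i j where rv: "p = (r, cls v, i, j)" "r \<in> borel_alg" "inj (\<lambda>a. r $ a $ a)"
    using p by (rule zero_fibre_rssE)
  obtain b where b: "b \<in> borel_grp" "b ** r ** matrix_inv b = diag_mat (\<chi> a. r $ a $ a)"
    using borel_diagonalizable[OF rv(2,3)] .
  define x where "x = (\<chi> a. r $ a $ a)"
  obtain v' i' j' where act: "act b p = (diag_mat x, cls v', i', j')"
    unfolding rv(1) act_cls[OF b(1)] b(2) x_def by blast
  have q: "(diag_mat x, cls v', i', j') \<in> zero_fibre_rss"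
    using act_zero_fibre_rss[OF b(1) p] by (simp add: act)
  have "Pmap p = (x, \<chi> a. v' $ a $ a)"
    using Pmap_act[OF b(1) p] Pmap_diag_mat[of x] rv(3) by (simp add: act x_def)
  then have "split_point (Pmap p) \<in> zariski cotangent_coords zero_fibre_rss closure_of orbit (act b p)"
    using diagonal_point_orbit_closure[OF q] by (simp add: act)
  then show ?thesis
    using closure_of_mono[OF orbit_act_subset[OF b(1)]] p zero_fibre_rss_cotangent by blast
qed

theorem theorem1p5:
  fixes X :: "('n::{finite,wellorder}) point set"
  defines "X \<equiv> zero_fibre_rss"
  shows
    \<comment> \<open>well-defined\<close>
    "(\<forall>(r, S, i, j)\<in>X. \<forall>c. trace (lprod r c) \<noteq> 0 \<and>
        (\<forall>v\<in>S. \<forall>w\<in>S. trace (lprod r c ** v) = trace (lprod r c ** w)))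
     \<and> Pmap ` X \<subseteq> config
     \<comment> \<open>regular\<close>
     \<and> regular_map cotangent_coords X config_coords config Pmap
     \<comment> \<open>invariant\<close>
     \<and> (\<forall>b\<in>borel_grp. \<forall>p\<in>X. act b p \<in> X \<and> Pmap (act b p) = Pmap p)
     \<comment> \<open>surjective\<close>
     \<and> Pmap ` X = config
     \<comment> \<open>separates orbit closures\<close>
     \<and> (\<forall>p1\<in>X. \<forall>p2\<in>X.
          zariski cotangent_coords X closure_of orbit p1 \<inter>
          zariski cotangent_coords X closure_of orbit p2 = {} \<longrightarrow> Pmap p1 \<noteq> Pmap p2)"
proof (intro conjI)
  show "\<forall>(r, S, i, j)\<in>X. \<forall>c. trace (lprod r c) \<noteq> 0 \<and>
        (\<forall>v\<in>S. \<forall>w\<in>S. trace (lprod r c ** v) = trace (lprod r c ** w))"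
  proof clarify
    fix r S i j c assume "(r, S, i, j) \<in> X"
    then obtain u where u: "S = cls u" "r \<in> borel_alg" "inj (\<lambda>a. r $ a $ a)"
      unfolding X_def by (auto elim: zero_fibre_rssE)
    have "trace (lprod r c ** v) = trace_dual (lprod r c) S" if "v \<in> S" for v
    proof -
      have "S = cls v" using that by (simp add: u mem_cls cls_eq_iff)
      then show ?thesis by (simp add: trace_dual_cls lprod_borel u(2))
    qed
    then show "trace (lprod r c) \<noteq> 0 \<and>
        (\<forall>v\<in>S. \<forall>w\<in>S. trace (lprod r c ** v) = trace (lprod r c ** w))"
      using trace_lprod_nonzero[OF u(2,3)] by simp
  qed
  show "Pmap ` X \<subseteq> config" unfolding X_def using Pmap_config by blast
  show "regular_map cotangent_coords X config_coords config Pmap"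
    unfolding X_def by (rule regular_map_Pmap)
  show "\<forall>b\<in>borel_grp. \<forall>p\<in>X. act b p \<in> X \<and> Pmap (act b p) = Pmap p"
    unfolding X_def by (simp add: act_zero_fibre_rss Pmap_act)
  show "Pmap ` X = config"
  proof
    show "config \<subseteq> Pmap ` X"
      unfolding X_def using split_point_zero_fibre_rss Pmap_split_point by (metis image_eqI subsetI)
  qed fact
  show "\<forall>p1\<in>X. \<forall>p2\<in>X.
          zariski cotangent_coords X closure_of orbit p1 \<inter>
          zariski cotangent_coords X closure_of orbit p2 = {} \<longrightarrow> Pmap p1 \<noteq> Pmap p2"
    unfolding X_def using split_point_in_orbit_closure by (metis IntI empty_iff)
qed

end
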